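(* For every integer $s\ge1$, \[ \begin{split} \sum_{i = 2}^s \binom{2s-i-1}{s-1}\sum_{\mu = 1}^\infty \frac{H_{\mu ,i} }{\mu ^{3s - i} } &= \binom{2s-1}{s-1}\frac{2\zeta (3s)}{2 + ( - 1)^s } - \binom{2s-2}{s-1}\frac{(3s + 1)\zeta (3s)}{2} + \frac{1}{2}\binom{2s-2}{s-1}\sum_{i = 1}^{3s - 3} \zeta (3s - i - 1)\zeta (i + 1)\\ &\quad + \frac{2}{2( - 1)^s + 1}\sum_{i = 1}^{\lfloor s/2 \rfloor } \binom{2s-2i-1}{s-1}\zeta (2i)\zeta (3s - 2i). \end{split} \]
   Context: $H_{\mu,i}=\sum_{k=1}^\mu k^{-i}$ is a generalized harmonic number and $\zeta$ is the Riemann zeta function. Empty sums are zero. *)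

theory Defs
  imports "HOL-Analysis.Analysis"
begin

definition gen_harm :: "nat \<Rightarrow> nat \<Rightarrow> real" where
  "gen_harm m i = (\<Sum>k=1..m. 1 / real k ^ i)"

(* The Riemann zeta function on the half-line x > 1, the domain of its defining Dirichlet
   series.  For x \<le> 1 the series diverges and the value is meaningless; in particular it is
   not the analytic continuation. *)
definition zeta :: "real \<Rightarrow> real" where
  "zeta x = (\<Sum>n. 1 / real (Suc n) powr x)"

end

theory Submission
  imports Defs
begin

text \<open>
  Write \<open>T = \<Sum>\<^sub>m\<^sub>,\<^sub>n 1 / (m\<^sup>s n\<^sup>s (m + n)\<^sup>s)\<close> and let \<open>X\<close> be the left-hand side extended by its
  term \<open>i = 1\<close>. Expanding \<open>1 / (m\<^sup>s n\<^sup>s)\<close> in partial fractions and collecting the terms with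
  \<open>m + n = N\<close> gives \<open>T = 2 X - 2 C \<zeta>(3s)\<close>, where \<open>C\<close> is the binomial coefficient \<open>2s - 1\<close> over \<open>s - 1\<close>.
  The same expansion of \<open>1 / ((-p)\<^sup>s (N + p)\<^sup>s)\<close>, summed over \<open>p\<close> for fixed \<open>N\<close>, makes the zeta values
  at odd arguments cancel and gives \<open>(-1)\<^sup>s T = 2 W - X\<close> with \<open>W\<close> the final sum of the theorem. These two
  linear equations determine \<open>X\<close>; its term \<open>i = 1\<close> is evaluated by Euler's formula for
  \<open>\<Sum>\<^sub>n H\<^sub>n / n\<^sup>q\<close>.
\<close>

section \<open>Unconditional sums over the positive integers\<close>

lemma has_sum_finite_sum:
  fixes f :: "'a \<Rightarrow> 'b \<Rightarrow> real"
  assumes "finite I" and "\<And>i. i \<in> I \<Longrightarrow> (f i has_sum S i) A"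
  shows "((\<lambda>x. \<Sum>i\<in>I. f i x) has_sum (\<Sum>i\<in>I. S i)) A"
  using assms by (induction I rule: finite_induct) (auto intro!: has_sum_add)

lemma has_sum_diff:
  fixes f g :: "'a \<Rightarrow> real"
  assumes "(f has_sum S) A" "(g has_sum T) A"
  shows "((\<lambda>x. f x - g x) has_sum S - T) A"
  using has_sum_add[OF assms(1) has_sum_uminusI[OF assms(2)]] by simp

text \<open>Bridge between two index conventions: \<open>zeta\<close> and the theorem sum over
  \<open>Suc n\<close> from \<open>n = 0\<close>, while the double-series arguments use
  unconditional sums over \<open>{1..}\<close>.\<close>

lemma has_sum_imp_suminf_Suc:
  fixes f :: "nat \<Rightarrow> real"
  assumes "(f has_sum S) {1..}"
  shows "(\<Sum>n. f (Suc n)) = S"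
proof -
  have "((\<lambda>n. f (Suc n)) has_sum S) UNIV"
    using assms
    by (subst has_sum_reindex_bij_witness[where T = "{1..}" and j = Suc and i = "\<lambda>n. n - 1" and h = f]) auto
  then show ?thesis
    by (metis has_sum_imp_sums sums_unique)
qed

lemma zeta_has_sum:
  assumes "k \<ge> 2"
  shows "((\<lambda>n. 1 / real n ^ k) has_sum zeta (real k)) {1..}"
proof -
  have "summable (\<lambda>n. 1 / real (Suc n) ^ k)"
    using inverse_power_summable[OF assms, where ?'a = real]
    by (subst summable_Suc_iff) (simp add: inverse_eq_divide)
  then have "(\<lambda>n. 1 / real (Suc n) ^ k) summable_on UNIV"
    by (intro summable_nonneg_imp_summable_on) auto
  then obtain S where "((\<lambda>n. 1 / real (Suc n) ^ k) has_sum S) UNIV"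
    by (auto simp: summable_on_def)
  then have "((\<lambda>n. 1 / real n ^ k) has_sum S) {1..}"
    by (subst (asm) has_sum_reindex_bij_witness[where T = "{1..}" and j = Suc and i = "\<lambda>n. n - 1" and h = "\<lambda>n. 1 / real n ^ k"]) auto
  moreover from has_sum_imp_suminf_Suc[OF this] have "zeta (real k) = S"
    by (simp add: zeta_def powr_realpow del: of_nat_Suc)
  ultimately show ?thesis by simp
qed

text \<open>Nonnegativity is what upgrades convergent iterated sums to summability on the product
  set.\<close>

lemma has_sum_Times_mult:
  fixes f :: "'a \<Rightarrow> real" and g :: "'b \<Rightarrow> real"
  assumes "(f has_sum S) A" "(g has_sum T) B"
    and "\<And>x. x \<in> A \<Longrightarrow> f x \<ge> 0" "\<And>y. y \<in> B \<Longrightarrow> g y \<ge> 0"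
  shows "((\<lambda>(x, y). f x * g y) has_sum S * T) (A \<times> B)"
proof (rule has_sum_SigmaI[where g = "\<lambda>x. f x * T"])
  show "((\<lambda>y. case (x, y) of (x, y) \<Rightarrow> f x * g y) has_sum f x * T) B" for x
    using has_sum_cmult_right[OF assms(2)] by simp
  then show "(\<lambda>(x, y). f x * g y) summable_on A \<times> B"
    using assms has_sum_cmult_left[OF assms(1), of T]
    by (intro summable_on_SigmaI) (auto simp: summable_on_def)
  show "((\<lambda>x. f x * T) has_sum S * T) A"
    using has_sum_cmult_left[OF assms(1)] by simp
qed

section \<open>The Tornheim double series, by rows and by diagonals\<close>

text \<open>The Mordell-Tornheim series. An infinite sum defaults to 0 when it diverges; the
  evaluations below take all exponents at least 1, where it converges.\<close>

definition tornheim :: "nat \<Rightarrow> nat \<Rightarrow> nat \<Rightarrow> real" where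
  "tornheim a b c =
    (\<Sum>\<^sub>\<infinity>(m, n)\<in>{1..} \<times> {1..}. 1 / (real m ^ a * real n ^ b * real (m + n) ^ c))"

text \<open>The bound \<open>m + n \<ge> sqrt (m n)\<close> dominates the series by a product of two convergent ones.\<close>

lemma tornheim_summable_1:
  "(\<lambda>(m, n). 1 / (real m * real n * real (m + n))) summable_on ({1..} \<times> {1..})"
proof -
  have "summable (\<lambda>n. real n powr (- 3 / 2))"
    by (subst summable_real_powr_iff) auto
  then have "(\<lambda>n. real n powr (- 3 / 2)) summable_on UNIV"
    by (intro summable_nonneg_imp_summable_on) auto
  then have "(\<lambda>n. real n powr (- 3 / 2)) summable_on {1..}"
    by (rule summable_on_subset_banach) auto
  then obtain S where "((\<lambda>n. real n powr (- 3 / 2)) has_sum S) {1..}"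
    by (auto simp: summable_on_def)
  from has_sum_Times_mult[OF this this]
  have "(\<lambda>(m, n). real m powr (- 3 / 2) * real n powr (- 3 / 2)) summable_on ({1..} \<times> {1..})"
    by (auto simp: summable_on_def)
  moreover have "1 / (real m * real n * real (m + n)) \<le> real m powr (- 3 / 2) * real n powr (- 3 / 2)"
    if mn: "m \<ge> 1" "n \<ge> 1" for m n :: nat
  proof -
    have eq: "1 / (x * sqrt x) = x powr (- 3 / 2)" if "x > 0" for x :: real
    proof -
      have "x * sqrt x = x powr 1 * x powr (1 / 2)" using that by (simp add: powr_half_sqrt)
      also have "\<dots> = x powr (3 / 2)" by (subst powr_add[symmetric]) simp
      finally show ?thesis using that by (simp add: powr_minus_divide)
    qed
    have "sqrt (real m * real n) \<le> (real m + real n) / 2"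
      using arith_geo_mean_sqrt[of "real m" "real n"] by simp
    also have "\<dots> \<le> real m + real n" by simp
    finally have "sqrt m * sqrt n \<le> real (m + n)" by (simp add: real_sqrt_mult)
    then have "1 / (real m * real n * real (m + n)) \<le> 1 / (real m * real n * (sqrt m * sqrt n))"
      using mn by (intro divide_left_mono mult_left_mono) auto
    also have "\<dots> = (1 / (m * sqrt m)) * (1 / (n * sqrt n))" by simp
    also have "\<dots> = real m powr (- 3 / 2) * real n powr (- 3 / 2)"
      using mn by (subst (1 2) eq) auto
    finally show ?thesis .
  qed
  ultimately show ?thesis
    by (elim summable_on_comparison_test) auto
qed

text \<open>Raising a base \<open>k >= 1\<close> to an exponent at least 1 does not decrease it, so
  the case of exponents \<open>1, 1, 1\<close> dominates.\<close>

lemma tornheim_has_sum: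
  assumes "a \<ge> 1" "b \<ge> 1" "c \<ge> 1"
  shows "((\<lambda>(m, n). 1 / (real m ^ a * real n ^ b * real (m + n) ^ c)) has_sum tornheim a b c)
    ({1..} \<times> {1..})"
proof -
  have "1 / (real m ^ a * real n ^ b * real (m + n) ^ c) \<le> 1 / (real m * real n * real (m + n))"
    if "m \<ge> 1" "n \<ge> 1" for m n :: nat
  proof -
    have "real k \<le> real k ^ d" if "k \<ge> 1" "d \<ge> 1" for k d :: nat
      using that self_le_power[of "real k" d] by simp
    from this[of m a] this[of n b] this[of "m + n" c] that assms show ?thesis
      by (intro divide_left_mono mult_mono) auto
  qed
  then have "(\<lambda>(m, n). 1 / (real m ^ a * real n ^ b * real (m + n) ^ c)) summable_on ({1..} \<times> {1..})"
    by (intro summable_on_comparison_test[OF tornheim_summable_1]) auto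
  then show ?thesis
    unfolding tornheim_def by (rule has_sum_infsum)
qed

lemma tornheim_rows:
  assumes "a \<ge> 1" "b \<ge> 1" "c \<ge> 1"
    and "\<And>m. m \<ge> 1 \<Longrightarrow>
      ((\<lambda>n. 1 / (real m ^ a * real n ^ b * real (m + n) ^ c)) has_sum g m) {1..}"
  shows "(g has_sum tornheim a b c) {1..}"
  using has_sum_SigmaD[OF tornheim_has_sum[OF assms(1-3)], of g] assms(4) by simp

text \<open>The bijection \<open>(m, n) -> (m + n, m)\<close> collects the pairs with a common sum,
  which makes the inner sums finite. The other index becomes a difference of reals, ready for field
  arithmetic; the diagonal \<open>n = 1\<close> is empty.\<close>

lemma tornheim_diagonals:
  assumes "a \<ge> 1" "b \<ge> 1" "c \<ge> 1"
  shows "((\<lambda>n. \<Sum>m\<in>{1..<n}. 1 / (real m ^ a * (real n - real m) ^ b * real n ^ c))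
    has_sum tornheim a b c) {1..}"
proof -
  let ?f = "\<lambda>(n, m). 1 / (real m ^ a * (real n - real m) ^ b * real n ^ c)"
  have "(?f has_sum tornheim a b c) (Sigma {1..} (\<lambda>n. {1..<n}))"
    using tornheim_has_sum[OF assms]
    by (subst has_sum_reindex_bij_witness[where T = "{1..} \<times> {1..}"
          and j = "\<lambda>(n, m). (m, n - m)" and i = "\<lambda>(m, n). (m + n, m)"
          and h = "\<lambda>(m, n). 1 / (real m ^ a * real n ^ b * real (m + n) ^ c)"])
      (auto simp: of_nat_diff)
  from has_sum_SigmaD[OF this] show ?thesis by (auto intro!: has_sum_finite)
qed

section \<open>Series involving harmonic numbers\<close>

text \<open>Induction on \<open>n\<close>: passing to \<open>n + 1\<close> adds the telescoping
  series of \<open>1 / (n + p) - 1 / (n + p + 1)\<close>, whose sum \<open>1 / (n + 1)\<close> is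
  the next term of the harmonic number.\<close>

lemma telescope_has_sum_gen_harm:
  "((\<lambda>p. 1 / real p - 1 / (real n + real p)) has_sum gen_harm n 1) {1..}"
proof (induction n)
  case 0
  then show ?case by (simp add: gen_harm_def)
next
  case (Suc n)
  have "(\<lambda>k. 1 / (real n + real (Suc k)) - 1 / (real n + real (Suc (Suc k)))) sums
      (1 / (real n + real (Suc 0)) - 0)"
    using LIMSEQ_ignore_initial_segment[OF lim_inverse_n', of "Suc n"]
    by (intro telescope_sums') (simp add: add_ac)
  then have "((\<lambda>k. 1 / (real n + real (Suc k)) - 1 / (real n + real (Suc (Suc k)))) has_sum
      (1 / (real n + 1))) UNIV"
    by (intro sums_nonneg_imp_has_sum) (auto simp: field_simps)
  then have "((\<lambda>p. 1 / (real n + real p) - 1 / (real n + real (Suc p))) has_sum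
      (1 / (real n + 1))) {1..}"
    by (subst has_sum_reindex_bij_witness[where T = UNIV and i = Suc and j = "\<lambda>n. n - 1"
      and h = "\<lambda>k. 1 / (real n + real (Suc k)) - 1 / (real n + real (Suc (Suc k)))"]) auto
  from has_sum_add[OF Suc this] show ?case by (simp add: gen_harm_def add_ac)
qed

lemma zeta_tail_has_sum:
  assumes "i \<ge> 2"
  shows "((\<lambda>p. 1 / (real n + real p) ^ i) has_sum zeta (real i) - gen_harm n i) {1..}"
proof -
  have "((\<lambda>k. 1 / real k ^ i) has_sum zeta (real i) - gen_harm n i) ({1..} - {1..n})"
    unfolding gen_harm_def by (intro has_sum_Diff zeta_has_sum assms has_sum_finite) auto
  then show ?thesis
    by (subst has_sum_reindex_bij_witness[where T = "{1..} - {1..n}" and j = "\<lambda>p. n + p"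
      and i = "\<lambda>k. k - n" and h = "\<lambda>k. 1 / real k ^ i"]) auto
qed

lemma tornheim_row_gen_harm:
  assumes "m \<ge> 1"
  shows "((\<lambda>n. 1 / (real n * real (m + n))) has_sum gen_harm m 1 / real m) {1..}"
proof -
  have "((\<lambda>n. (1 / real m) * (1 / real n - 1 / (real m + real n))) has_sum (1 / real m) * gen_harm m 1) {1..}"
    by (intro has_sum_cmult_right telescope_has_sum_gen_harm)
  also have "?this \<longleftrightarrow> ?thesis"
    using assms by (subst mult_1_left[symmetric], subst times_divide_eq_left[symmetric], intro has_sum_cong) (auto simp: field_simps)
  finally show ?thesis .
qed

text \<open>Row \<open>m\<close> of the Tornheim series is evaluated with
  \<open>1 / (n (m + n)) = (1 / n - 1 / (m + n)) / m\<close>. This gives both the convergence of the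
  harmonic series and one of the two evaluations behind Euler's formula.\<close>

lemma gen_harm_has_sum_tornheim:
  assumes "q \<ge> 2"
  shows "((\<lambda>n. gen_harm n 1 / real n ^ q) has_sum tornheim (q - 1) 1 1) {1..}"
proof (rule tornheim_rows)
  fix m :: nat assume "m \<ge> 1"
  from has_sum_cmult_right[OF tornheim_row_gen_harm[OF this], of "1 / real m ^ (q - 1)"]
  have "((\<lambda>n. 1 / (real m ^ (q - 1) * real n ^ 1 * real (m + n) ^ 1)) has_sum 
      (1 / real m ^ (q - 1)) * (gen_harm m 1 / real m)) {1..}" by (simp add: mult_ac)
  moreover have "real m ^ q = real m ^ (q - 1) * real m"
    using assms by (cases q) auto
  ultimately show "((\<lambda>n. 1 / (real m ^ (q - 1) * real n ^ 1 * real (m + n) ^ 1)) has_sum 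
      gen_harm m 1 / real m ^ q) {1..}" by (simp add: mult_ac)
qed (use assms in auto)

text \<open>Convergence follows by comparison with \<open>i = 1\<close>, since
  \<open>k <= k ^ i\<close>. Hence the infinite sums in the theorem are genuine limits.\<close>

lemma gen_harm_has_sum:
  assumes "i \<ge> 1" "q \<ge> 2"
  shows "((\<lambda>n. gen_harm n i / real n ^ q) has_sum
    (\<Sum>n. gen_harm (Suc n) i / real (Suc n) ^ q)) {1..}"
proof -
  have "(\<lambda>n. gen_harm n 1 / real n ^ q) summable_on {1..}"
    using gen_harm_has_sum_tornheim[OF assms(2)] by (auto simp: summable_on_def)
  then have "(\<lambda>n. gen_harm n i / real n ^ q) summable_on {1..}"
  proof (rule summable_on_comparison_test)
    fix n :: nat
    show "gen_harm n i / real n ^ q \<ge> 0"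
      by (auto simp: gen_harm_def intro!: divide_nonneg_nonneg sum_nonneg)
    have "gen_harm n i \<le> gen_harm n 1"
      unfolding gen_harm_def using assms(1) self_le_power[of "real k" i for k]
      by (intro sum_mono divide_left_mono) auto
    then show "gen_harm n i / real n ^ q \<le> gen_harm n 1 / real n ^ q"
      by (intro divide_right_mono) auto
  qed
  then obtain S where "((\<lambda>n. gen_harm n i / real n ^ q) has_sum S) {1..}"
    by (auto simp: summable_on_def)
  with has_sum_imp_suminf_Suc[OF this] show ?thesis by simp
qed

section \<open>Euler's formula for linear harmonic sums\<close>

lemma gen_harm_pred:
  assumes "n \<ge> 1"
  shows "(\<Sum>m\<in>{1..<n}. 1 / real m ^ i) = gen_harm n i - 1 / real n ^ i"
proof -
  have "{1..n} = insert n {1..<n}" using assms by auto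
  then show ?thesis by (simp add: gen_harm_def)
qed

lemma sum_reflect_interval:
  fixes f :: "real \<Rightarrow> real"
  shows "(\<Sum>m\<in>{1..<n}. f (real n - real m)) = (\<Sum>m\<in>{1..<n}. f (real m))"
  by (rule sum.reindex_bij_witness[where i = "\<lambda>m. n - m" and j = "\<lambda>m. n - m"])
    (auto simp: of_nat_diff)

text \<open>The factor \<open>y - x\<close> makes the sum telescope along
  \<open>1 / (x ^ i * y ^ (q - i))\<close>. For \<open>q = 2\<close> the sum is empty and the
  right-hand side vanishes.\<close>

lemma geometric_difference:
  fixes x y :: real
  assumes "x \<noteq> 0" "y \<noteq> 0" "q \<ge> 2"
  shows "(\<Sum>i\<in>{1..<q - 1}. 1 / x ^ (i + 1) * (1 / y ^ (q - i))) * (y - x)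
    = 1 / (x ^ (q - 1) * y) - 1 / (x * y ^ (q - 1))"
proof -
  have "(\<Sum>i\<in>{1..<q - 1}. 1 / x ^ (i + 1) * (1 / y ^ (q - i))) * (y - x)
    = (\<Sum>i\<in>{1..<q - 1}. 1 / (x ^ Suc i * y ^ (q - Suc i)) - 1 / (x ^ i * y ^ (q - i)))"
    unfolding sum_distrib_right
  proof (rule sum.cong)
    fix i assume "i \<in> {1..<q - 1}"
    then have "q - i = Suc (q - Suc i)" by auto
    then have "y ^ (q - i) = y * y ^ (q - Suc i)" by simp
    then show "1 / x ^ (i + 1) * (1 / y ^ (q - i)) * (y - x)
        = 1 / (x ^ Suc i * y ^ (q - Suc i)) - 1 / (x ^ i * y ^ (q - i))"
      using assms by (simp add: field_simps)
  qed simp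
  also have "\<dots> = 1 / (x ^ (q - 1) * y ^ (q - (q - 1))) - 1 / (x ^ 1 * y ^ (q - 1))"
    using assms(3) by (subst sum_Suc_diff') auto
  also have "q - (q - 1) = 1" using assms(3) by auto
  finally show ?thesis by simp
qed

text \<open>With \<open>x\<close> and \<open>x + h\<close> as coordinates of an off-diagonal point,
  the right-hand side is the difference of the summands of \<open>tornheim (q - 1) 1 1\<close> and
  \<open>tornheim 1 1 (q - 1)\<close> at \<open>(x, h)\<close>. Both triangles give the same value
  because exchanging the coordinates flips the sign of the telescoped difference and of the
  divisor.\<close>

lemma geometric_difference_shift:
  fixes x h :: real
  assumes "x > 0" "h > 0" "q \<ge> 2"
  shows "(\<Sum>i\<in>{1..<q - 1}. 1 / x ^ (i + 1) * (1 / (x + h) ^ (q - i)))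
      = 1 / (x ^ (q - 1) * h * (x + h)) - 1 / (x * h * (x + h) ^ (q - 1))" (is "?A = ?R")
    and "(\<Sum>i\<in>{1..<q - 1}. 1 / (x + h) ^ (i + 1) * (1 / x ^ (q - i)))
      = 1 / (x ^ (q - 1) * h * (x + h)) - 1 / (x * h * (x + h) ^ (q - 1))" (is "?B = ?R")
proof -
  let ?D = "1 / (x ^ (q - 1) * (x + h)) - 1 / (x * (x + h) ^ (q - 1))"
  have "?A * h = ?D" using geometric_difference[of x "x + h" q] assms by simp
  then have A: "?A = ?D / h" using assms by (simp add: eq_divide_eq)
  have "?B * (- h) = 1 / ((x + h) ^ (q - 1) * x) - 1 / ((x + h) * x ^ (q - 1))"
    using geometric_difference[of "x + h" x q] assms by simp
  also have "\<dots> = - ?D" by (simp add: mult.commute)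
  finally have B: "?B = ?D / h" using assms by (simp add: eq_divide_eq)
  have "?D / h = ?R" by (simp add: diff_divide_distrib mult_ac)
  with A B show "?A = ?R" "?B = ?R" by simp_all
qed

text \<open>
  The product of zeta values is a double series over all pairs \<open>(m, n)\<close>, which is split into the
  diagonal and the two triangles. On a triangle, the sum over \<open>i\<close> is geometric.
\<close>

lemma euler_sum:
  assumes "q \<ge> 2"
  shows "(\<Sum>n. gen_harm (Suc n) 1 / real (Suc n) ^ q)
    = (real q + 2) / 2 * zeta (real (q + 1))
      - 1 / 2 * (\<Sum>i\<in>{1..<q - 1}. zeta (real (i + 1)) * zeta (real (q - i)))"
proof -
  define X where "X = (\<Sum>n. gen_harm (Suc n) 1 / real (Suc n) ^ q)"
  let ?U = "tornheim (q - 1) 1 1" and ?V = "tornheim 1 1 (q - 1)"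
  have U: "?U = X"
    using gen_harm_has_sum_tornheim[OF assms] gen_harm_has_sum[OF _ assms, of 1]
    by (auto simp: X_def intro: has_sum_unique)
  \<comment> \<open>\<open>?V\<close> is summed along diagonals, using
    \<open>1 / (m (n - m)) = (1 / m + 1 / (n - m)) / n\<close>; reflecting \<open>m\<close> to
    \<open>n - m\<close> shows that the two halves agree.\<close>
  have "((\<lambda>n. 2 * (gen_harm n 1 / real n ^ q - 1 / real n ^ (q + 1))) has_sum ?V) {1..}"
  proof -
    have "(\<Sum>m\<in>{1..<n}. 1 / (real m ^ 1 * (real n - real m) ^ 1 * real n ^ (q - 1)))
        = 2 * (gen_harm n 1 / real n ^ q - 1 / real n ^ (q + 1))" if "n \<in> {1..}" for n
    proof -
      have q: "real n ^ q = real n ^ (q - 1) * real n" using assms by (cases q) auto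
      have "(\<Sum>m\<in>{1..<n}. 1 / (real m ^ 1 * (real n - real m) ^ 1 * real n ^ (q - 1)))
          = (\<Sum>m\<in>{1..<n}. 1 / real n ^ q * (1 / real m + 1 / (real n - real m)))"
        unfolding q using that by (intro sum.cong) (auto simp: field_simps)
      also have "\<dots> = 1 / real n ^ q * ((\<Sum>m\<in>{1..<n}. 1 / real m) + (\<Sum>m\<in>{1..<n}. 1 / (real n - real m)))"
        by (simp only: sum_distrib_left[symmetric] sum.distrib)
      also have "(\<Sum>m\<in>{1..<n}. 1 / (real n - real m)) = (\<Sum>m\<in>{1..<n}. 1 / real m)"
        by (rule sum_reflect_interval)
      also have "(\<Sum>m\<in>{1..<n}. 1 / real m) = gen_harm n 1 - 1 / real n"
        using gen_harm_pred[of n 1] that by simp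
      finally show ?thesis by (simp add: diff_divide_distrib right_diff_distrib mult_ac)
    qed
    then show ?thesis
      by (rule has_sum_cong[THEN iffD1, OF _ tornheim_diagonals]) (use assms in auto)
  qed
  moreover have "((\<lambda>n. 2 * (gen_harm n 1 / real n ^ q - 1 / real n ^ (q + 1))) has_sum
      2 * (X - zeta (real (q + 1)))) {1..}"
    unfolding X_def using assms
    by (intro has_sum_cmult_right has_sum_diff gen_harm_has_sum zeta_has_sum) auto
  ultimately have V: "?V = 2 * (X - zeta (real (q + 1)))" by (rule has_sum_unique)

  define g where "g = (\<lambda>(m, n). \<Sum>i\<in>{1..<q - 1}. 1 / real m ^ (i + 1) * (1 / real n ^ (q - i)))"
  let ?P = "{1..} \<times> {1..} :: (nat \<times> nat) set"
  have UV: "((\<lambda>(m, n). 1 / (real m ^ (q - 1) * real n ^ 1 * real (m + n) ^ 1)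
      - 1 / (real m ^ 1 * real n ^ 1 * real (m + n) ^ (q - 1))) has_sum (?U - ?V)) ?P"
    using has_sum_diff[OF tornheim_has_sum[of "q - 1" 1 1] tornheim_has_sum[of 1 1 "q - 1"]] assms
    by (simp add: case_prod_unfold)
  have above: "(g has_sum (?U - ?V)) {(m, n). 1 \<le> m \<and> m < n}"
  proof (subst has_sum_reindex_bij_witness[where T = ?P and i = "\<lambda>(m, p). (m, m + p)"
        and j = "\<lambda>(m, n). (m, n - m)", OF _ _ _ _ _ refl])
    fix a :: "nat \<times> nat" assume "a \<in> {(m, n). 1 \<le> m \<and> m < n}"
    then show "(case case a of (m, n) \<Rightarrow> (m, n - m) of (m, n) \<Rightarrow>
        1 / (real m ^ (q - 1) * real n ^ 1 * real (m + n) ^ 1)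
      - 1 / (real m ^ 1 * real n ^ 1 * real (m + n) ^ (q - 1))) = g a"
      using geometric_difference_shift(1)[of "real (fst a)" "real (snd a - fst a)" q] assms
      by (auto simp: g_def of_nat_diff)
  qed (use UV in auto)
  have below: "(g has_sum (?U - ?V)) {(m, n). 1 \<le> n \<and> n < m}"
  proof (subst has_sum_reindex_bij_witness[where T = ?P and i = "\<lambda>(n, p). (n + p, n)"
        and j = "\<lambda>(m, n). (n, m - n)", OF _ _ _ _ _ refl])
    fix a :: "nat \<times> nat" assume "a \<in> {(m, n). 1 \<le> n \<and> n < m}"
    then show "(case case a of (m, n) \<Rightarrow> (n, m - n) of (m, n) \<Rightarrow>
        1 / (real m ^ (q - 1) * real n ^ 1 * real (m + n) ^ 1)
      - 1 / (real m ^ 1 * real n ^ 1 * real (m + n) ^ (q - 1))) = g a"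
      using geometric_difference_shift(2)[of "real (snd a)" "real (fst a - snd a)" q] assms
      by (auto simp: g_def of_nat_diff)
  qed (use UV in auto)
  \<comment> \<open>On the diagonal all \<open>q - 2\<close> values of \<open>i\<close> contribute
    the same term \<open>1 / m ^ (q + 1)\<close>.\<close>
  have "((\<lambda>m. (real q - 2) * (1 / real m ^ (q + 1))) has_sum (real q - 2) * zeta (real (q + 1))) {1..}"
    using assms by (intro has_sum_cmult_right zeta_has_sum) auto
  moreover have "g (m, m) = (real q - 2) * (1 / real m ^ (q + 1))" for m
  proof -
    have "g (m, m) = (\<Sum>i\<in>{1..<q - 1}. 1 / real m ^ (q + 1))"
      unfolding g_def prod.case
      by (intro sum.cong) (auto simp: power_add[symmetric] simp del: power_Suc)
    then show ?thesis using assms by (simp add: of_nat_diff)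
  qed
  ultimately have diag: "(g has_sum (real q - 2) * zeta (real (q + 1))) ((\<lambda>m. (m, m)) ` {1..})"
    by (subst has_sum_reindex) (simp_all add: o_def inj_on_def)
  have P: "?P = ((\<lambda>m. (m, m)) ` {1..} \<union> {(m, n). 1 \<le> m \<and> m < n}) \<union> {(m, n). 1 \<le> n \<and> n < m}"
    by auto
  have "(g has_sum ((real q - 2) * zeta (real (q + 1)) + (?U - ?V)) + (?U - ?V)) ?P"
    unfolding P by (intro has_sum_Un_disjoint diag above below) auto
  moreover have "(g has_sum (\<Sum>i\<in>{1..<q - 1}. zeta (real (i + 1)) * zeta (real (q - i)))) ?P"
    unfolding g_def case_prod_unfold
  proof (rule has_sum_finite_sum)
    fix i assume "i \<in> {1..<q - 1}"
    then have "2 \<le> i + 1" "2 \<le> q - i" by auto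
    then show "((\<lambda>x. 1 / real (fst x) ^ (i + 1) * (1 / real (snd x) ^ (q - i))) has_sum
        zeta (real (i + 1)) * zeta (real (q - i))) ?P"
      by (rule has_sum_Times_mult[unfolded case_prod_unfold, OF zeta_has_sum zeta_has_sum]) simp_all
  qed simp
  \<comment> \<open>Since \<open>?U - ?V = 2 * zeta (q + 1) - X\<close>, this is a linear equation
    for \<open>X\<close>.\<close>
  ultimately have "(real q - 2) * zeta (real (q + 1)) + (?U - ?V) + (?U - ?V)
      = (\<Sum>i\<in>{1..<q - 1}. zeta (real (i + 1)) * zeta (real (q - i)))"
    by (rule has_sum_unique)
  then show ?thesis unfolding U V X_def[symmetric] by (simp add: field_simps)
qed

section \<open>Partial fractions and their binomial coefficients\<close>

text \<open>A truncated form of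
  \<open>(1 - v) * (1 - v) ^ (-(t + 2)) = (1 - v) ^ (-(t + 1))\<close>: the sums are partial
  binomial series and the last term is the truncation error. Pascal's rule carries the
  induction.\<close>

lemma sum_choose_power_shift:
  fixes v :: real
  shows "(1 - v) * (\<Sum>k\<le>j. real ((Suc t + k) choose k) * v ^ k)
    = (\<Sum>k\<le>j. real ((t + k) choose k) * v ^ k) - real ((Suc t + j) choose j) * v ^ Suc j"
proof (induction j)
  case (Suc j)
  let ?A = "\<Sum>k\<le>j. real ((Suc t + k) choose k) * v ^ k"
  let ?b = "real ((Suc t + j) choose j)" and ?c = "real ((t + Suc j) choose Suc j)"
  let ?B = "\<Sum>k\<le>j. real ((t + k) choose k) * v ^ k"
  have bc: "real ((Suc t + Suc j) choose Suc j) = ?b + ?c" by simp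
  have "(1 - v) * (?A + (?b + ?c) * v ^ Suc j) = (1 - v) * ?A + (1 - v) * ((?b + ?c) * v ^ Suc j)"
    by (rule distrib_left)
  also have "\<dots> = (?B + ?c * v ^ Suc j) - (?b + ?c) * v ^ Suc (Suc j)"
    unfolding Suc by (simp only: power_Suc algebra_simps)
  finally show ?case by (simp only: sum.atMost_Suc bc)
qed simp

text \<open>For \<open>u\<close> and \<open>v\<close> in \<open>[0, 1]\<close> this is the certainty
  that one of two players is first to win \<open>t + 1\<close> rounds, \<open>k\<close> being the
  number of rounds won by the loser. For arbitrary reals it holds by induction on \<open>t\<close>:
  the two halves change by multiples of \<open>1 - 2 * v\<close> and \<open>1 - 2 * u\<close> with a
  common factor, and these cancel because \<open>u + v = 1\<close>.\<close>

lemma partial_fraction_unity: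
  fixes u v :: real
  assumes "u + v = 1"
  shows "u ^ Suc t * (\<Sum>k\<le>t. real ((t + k) choose k) * v ^ k)
    + v ^ Suc t * (\<Sum>k\<le>t. real ((t + k) choose k) * u ^ k) = 1"
proof (induction t)
  case 0
  then show ?case using assms by simp
next
  case (Suc t)
  let ?F = "\<lambda>t v. \<Sum>k\<le>t. real ((t + k) choose k) * v ^ k"
  \<comment> \<open>Half of the central coefficient \<open>(2 * t + 2) choose (t + 1)\<close>. It is
    both the last coefficient of the extended sum and, doubled, that of the truncation
    error.\<close>
  define c where "c = real ((2 * t + 1) choose (t + 1))"
  have c': "real ((Suc t + Suc t) choose Suc t) = 2 * c"
  proof -
    have "2 * t + 1 - t = t + 1" by simp
    with binomial_symmetric[of t "2 * t + 1"]
    have sym: "(2 * t + 1) choose t = (2 * t + 1) choose (t + 1)" by (simp only:)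
    have "(Suc t + Suc t) choose Suc t = Suc (2 * t + 1) choose Suc t"
      by (rule arg_cong[where f = "\<lambda>n. n choose Suc t"]) simp
    also have "\<dots> = 2 * ((2 * t + 1) choose (t + 1))"
      unfolding binomial_Suc_Suc[of "2 * t + 1" t] sym by (simp only: Suc_eq_plus1 mult_2)
    finally show ?thesis by (simp only: c_def of_nat_mult of_nat_numeral)
  qed
  have c: "real ((t + Suc t) choose Suc t) = c"
    unfolding c_def by (rule arg_cong2[where f = "\<lambda>n k. real (n choose k)"]) auto
  have F: "(1 - v) * ?F (Suc t) v = ?F t v + c * v ^ Suc t * (1 - 2 * v)" for v :: real
  proof -
    have "(1 - v) * ?F (Suc t) v = ?F t v + c * v ^ Suc t - 2 * c * v ^ Suc (Suc t)"
      using sum_choose_power_shift[of v t "Suc t"] by (simp only: c c' sum.atMost_Suc)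
    also have "\<dots> = ?F t v + c * v ^ Suc t * (1 - 2 * v)"
      by (simp add: right_diff_distrib mult_ac)
    finally show ?thesis .
  qed
  have u: "u = 1 - v" and v: "v = 1 - u" using assms by auto
  have pu: "u ^ Suc (Suc t) = u ^ Suc t * (1 - v)"
    unfolding u[symmetric] by (rule power_Suc2)
  have pv: "v ^ Suc (Suc t) = v ^ Suc t * (1 - u)"
    unfolding v[symmetric] by (rule power_Suc2)
  have "u ^ Suc (Suc t) * ?F (Suc t) v + v ^ Suc (Suc t) * ?F (Suc t) u
      = u ^ Suc t * ((1 - v) * ?F (Suc t) v) + v ^ Suc t * ((1 - u) * ?F (Suc t) u)"
    by (simp only: pu pv mult.assoc)
  also have "\<dots> = (u ^ Suc t * ?F t v + v ^ Suc t * ?F t u)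
      + c * (u ^ Suc t * v ^ Suc t) * (2 - 2 * (u + v))"
    unfolding F by (simp only: algebra_simps)
  also have "\<dots> = 1" unfolding Suc assms by simp
  finally show ?case .
qed

lemma partial_fractions:
  fixes x y :: real
  assumes "x \<noteq> 0" "y \<noteq> 0" "x + y \<noteq> 0" "s \<ge> 1"
  shows "1 / (x ^ s * y ^ s)
    = (\<Sum>i=1..s. real ((2 * s - i - 1) choose (s - 1)) / (x + y) ^ (2 * s - i) * (1 / x ^ i + 1 / y ^ i))"
proof -
  define t where "t = s - 1"
  have s: "s = Suc t" using assms(4) by (simp add: t_def)
  define z where "z = x + y"
  have z: "z \<noteq> 0" using assms by (simp add: z_def)
  have sum1: "x / z + y / z = 1" using assms by (simp add: z_def add_divide_distrib[symmetric])
  have term_eq: "(x / z) ^ s * (y / z) ^ k / (x ^ s * y ^ s) = 1 / (z ^ (s + k) * y ^ (s - k))"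
    if "k \<le> t" "x \<noteq> 0" "y \<noteq> 0" for k and x y :: real
  proof -
    have "y ^ s = y ^ (s - k) * y ^ k" using that by (simp add: s power_add[symmetric])
    then show ?thesis using that z by (simp add: power_divide power_add)
  qed
  have "1 / (x ^ s * y ^ s) = ((x / z) ^ s * (\<Sum>k\<le>t. real ((t + k) choose k) * (y / z) ^ k)
    + (y / z) ^ s * (\<Sum>k\<le>t. real ((t + k) choose k) * (x / z) ^ k)) / (x ^ s * y ^ s)"
    using partial_fraction_unity[OF sum1, of t] by (simp add: s)
  also have "\<dots> = (\<Sum>k\<le>t. real ((t + k) choose k) * ((x / z) ^ s * (y / z) ^ k / (x ^ s * y ^ s)
      + (y / z) ^ s * (x / z) ^ k / (y ^ s * x ^ s)))"
    by (simp add: sum_distrib_left sum_divide_distrib add_divide_distrib sum.distrib distrib_left mult_ac)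
  also have "\<dots> = (\<Sum>k\<le>t. real ((t + k) choose k) * (1 / (z ^ (s + k) * y ^ (s - k)) + 1 / (z ^ (s + k) * x ^ (s - k))))"
    using assms by (intro sum.cong refl) (simp add: term_eq)
  also have "\<dots> = (\<Sum>i=1..s. real ((2 * s - i - 1) choose (s - 1)) / z ^ (2 * s - i) * (1 / x ^ i + 1 / y ^ i))"
  proof (rule sum.reindex_bij_witness[where i = "\<lambda>i. s - i" and j = "\<lambda>k. s - k"])
    fix k assume k: "k \<in> {..t}"
    have "(t + k) choose k = (t + k) choose t" using binomial_symmetric[of k "t + k"] by simp
    moreover have "2 * s - (s - k) - 1 = t + k" "2 * s - (s - k) = s + k" "s - 1 = t" using k s by auto
    ultimately show "real ((2 * s - (s - k) - 1) choose (s - 1)) / z ^ (2 * s - (s - k)) * (1 / x ^ (s - k) + 1 / y ^ (s - k))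
        = real ((t + k) choose k) * (1 / (z ^ (s + k) * y ^ (s - k)) + 1 / (z ^ (s + k) * x ^ (s - k)))"
      by (simp add: distrib_left add.commute)
  qed (auto simp: s)
  finally show ?thesis by (simp add: z_def)
qed

text \<open>With \<open>k = s - i\<close> this is the hockey-stick identity for
  \<open>(t + k) choose k\<close>. It gives the total weight of the \<open>zeta (3 * s)\<close>
  terms in the diagonal evaluation.\<close>

lemma sum_choose_central:
  assumes "s \<ge> 1"
  shows "(\<Sum>i=1..s. (2 * s - i - 1) choose (s - 1)) = (2 * s - 1) choose (s - 1)"
proof -
  define t where "t = s - 1"
  have s: "s = Suc t" using assms by (simp add: t_def)
  have "(\<Sum>i=1..s. (2 * s - i - 1) choose (s - 1)) = (\<Sum>k\<le>t. (t + k) choose k)"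
  proof (rule sum.reindex_bij_witness[where i = "\<lambda>k. s - k" and j = "\<lambda>i. s - i"])
    fix i assume i: "i \<in> {1..s}"
    then have "2 * s - i - 1 = t + (s - i)" by (auto simp: s)
    then show "(t + (s - i)) choose (s - i) = (2 * s - i - 1) choose (s - 1)"
      using binomial_symmetric[of "s - i" "t + (s - i)"] by (simp add: s)
  qed (auto simp: s)
  also have "\<dots> = (2 * s - 1) choose (s - 1)"
    by (simp add: sum_choose_lower s mult_2)
  finally show ?thesis .
qed

section \<open>Two evaluations of the symmetric Tornheim series\<close>

text \<open>For \<open>i >= 2\<close> this is \<open>(1 + (-1) ^ i) * zeta i\<close>, the sum of
  \<open>1 / p ^ i\<close> over the nonzero integers. The explicit 0 keeps the meaningless value
  \<open>zeta 1\<close> out.\<close>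

definition twice_even_zeta :: "nat \<Rightarrow> real" where
  "twice_even_zeta i = (if even i then 2 * zeta (real i) else 0)"

text \<open>For \<open>i = 1\<close> the two terms are summable only together.\<close>

lemma signed_tail_has_sum:
  assumes "i \<ge> 1"
  shows "((\<lambda>p. 1 / (- real p) ^ i + 1 / (real n + real p) ^ i) has_sum
    twice_even_zeta i - gen_harm n i) {1..}"
proof (cases "i = 1")
  case True
  have "((\<lambda>p. - (1 / real p - 1 / (real n + real p))) has_sum - gen_harm n 1) {1..}"
    by (intro has_sum_uminusI telescope_has_sum_gen_harm)
  then show ?thesis using True by (simp add: twice_even_zeta_def algebra_simps)
next
  case False
  with assms have i: "i \<ge> 2" by simp
  have "((\<lambda>p. (-1) ^ i * (1 / real p ^ i) + 1 / (real n + real p) ^ i) has_sum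
      (-1) ^ i * zeta (real i) + (zeta (real i) - gen_harm n i)) {1..}"
    using i by (intro has_sum_add has_sum_cmult_right zeta_has_sum zeta_tail_has_sum)
  moreover have "(-1) ^ i * (1 / real p ^ i) = 1 / (- real p) ^ i" for p
    by (cases "even i") auto
  moreover have "(-1) ^ i * zeta (real i) + (zeta (real i) - gen_harm n i)
      = twice_even_zeta i - gen_harm n i"
    by (simp add: twice_even_zeta_def)
  ultimately show ?thesis by (simp only:)
qed

text \<open>Partial fractions with \<open>x = m\<close>, \<open>y = n - m\<close>, hence
  \<open>x + y = n\<close>. Reflection yields the factor 2, and since \<open>m\<close> stops before
  \<open>n\<close>, each harmonic number lacks its last term, which accounts for the subtracted
  \<open>zeta (3 * s)\<close>.\<close>

lemma tornheim_diagonal_sum: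
  assumes "s \<ge> 1"
  shows "tornheim s s s = 2 * (\<Sum>i=1..s. real ((2 * s - i - 1) choose (s - 1)) *
    ((\<Sum>n. gen_harm (Suc n) i / real (Suc n) ^ (3 * s - i)) - zeta (real (3 * s))))"
proof -
  define c where "c = (\<lambda>i. real ((2 * s - i - 1) choose (s - 1)))"
  have "(\<Sum>m\<in>{1..<n}. 1 / (real m ^ s * (real n - real m) ^ s * real n ^ s))
      = 2 * (\<Sum>i=1..s. c i * (gen_harm n i / real n ^ (3 * s - i) - 1 / real n ^ (3 * s)))"
    if "n \<in> {1..}" for n
  proof -
    have "(\<Sum>m\<in>{1..<n}. 1 / (real m ^ s * (real n - real m) ^ s * real n ^ s))
        = (\<Sum>m\<in>{1..<n}. \<Sum>i=1..s. c i / real n ^ (3 * s - i) * (1 / real m ^ i + 1 / (real n - real m) ^ i))"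
    proof (rule sum.cong)
      fix m assume "m \<in> {1..<n}"
      then have "1 / (real m ^ s * (real n - real m) ^ s)
          = (\<Sum>i=1..s. c i / real n ^ (2 * s - i) * (1 / real m ^ i + 1 / (real n - real m) ^ i))"
        using partial_fractions[of "real m" "real n - real m" s] assms by (simp add: c_def)
      then have "1 / (real m ^ s * (real n - real m) ^ s * real n ^ s)
          = (\<Sum>i=1..s. c i / real n ^ (2 * s - i) * (1 / real m ^ i + 1 / (real n - real m) ^ i)) / real n ^ s"
        by (metis divide_divide_eq_left)
      also have "\<dots> = (\<Sum>i=1..s. c i / real n ^ (3 * s - i) * (1 / real m ^ i + 1 / (real n - real m) ^ i))"
        unfolding sum_divide_distrib
      proof (rule sum.cong)
        fix i assume "i \<in> {1..s}"
        then have "3 * s - i = (2 * s - i) + s" by auto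
        then have "real n ^ (3 * s - i) = real n ^ (2 * s - i) * real n ^ s" by (simp add: power_add)
        then show "c i / real n ^ (2 * s - i) * (1 / real m ^ i + 1 / (real n - real m) ^ i) / real n ^ s
            = c i / real n ^ (3 * s - i) * (1 / real m ^ i + 1 / (real n - real m) ^ i)" by simp
      qed simp
      finally show "1 / (real m ^ s * (real n - real m) ^ s * real n ^ s)
          = (\<Sum>i=1..s. c i / real n ^ (3 * s - i) * (1 / real m ^ i + 1 / (real n - real m) ^ i))" .
    qed simp
    also have "\<dots> = (\<Sum>i=1..s. \<Sum>m\<in>{1..<n}. c i / real n ^ (3 * s - i) * (1 / real m ^ i + 1 / (real n - real m) ^ i))"
      by (rule sum.swap)
    also have "\<dots> = (\<Sum>i=1..s. 2 * (c i * (gen_harm n i / real n ^ (3 * s - i) - 1 / real n ^ (3 * s))))"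
    proof (rule sum.cong)
      fix i assume i: "i \<in> {1..s}"
      have "(\<Sum>m\<in>{1..<n}. 1 / (real n - real m) ^ i) = (\<Sum>m\<in>{1..<n}. 1 / real m ^ i)"
        by (rule sum_reflect_interval)
      moreover have "(\<Sum>m\<in>{1..<n}. 1 / real m ^ i) = gen_harm n i - 1 / real n ^ i"
        using that by (intro gen_harm_pred) simp
      moreover have "real n ^ (3 * s) = real n ^ (3 * s - i) * real n ^ i"
        using i by (simp flip: power_add)
      ultimately show "(\<Sum>m\<in>{1..<n}. c i / real n ^ (3 * s - i) * (1 / real m ^ i + 1 / (real n - real m) ^ i))
          = 2 * (c i * (gen_harm n i / real n ^ (3 * s - i) - 1 / real n ^ (3 * s)))"
        unfolding sum_distrib_left[symmetric] sum.distrib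
        by (simp add: right_diff_distrib diff_divide_distrib mult_ac)
    qed simp
    finally show ?thesis by (simp add: sum_distrib_left)
  qed
  then have "((\<lambda>n. 2 * (\<Sum>i=1..s. c i * (gen_harm n i / real n ^ (3 * s - i) - 1 / real n ^ (3 * s))))
      has_sum tornheim s s s) {1..}"
    by (rule has_sum_cong[THEN iffD1, OF _ tornheim_diagonals]) (use assms in auto)
  \<comment> \<open>For \<open>i <= s\<close> the exponent \<open>3 * s - i\<close> is at least 2,
    so the series may be summed term by term.\<close>
  moreover have "((\<lambda>n. 2 * (\<Sum>i=1..s. c i * (gen_harm n i / real n ^ (3 * s - i) - 1 / real n ^ (3 * s))))
      has_sum 2 * (\<Sum>i=1..s. c i * ((\<Sum>n. gen_harm (Suc n) i / real (Suc n) ^ (3 * s - i)) - zeta (real (3 * s))))) {1..}"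
    by (intro has_sum_cmult_right has_sum_finite_sum has_sum_diff gen_harm_has_sum zeta_has_sum) auto
  ultimately show ?thesis unfolding c_def by (rule has_sum_unique)
qed

text \<open>Partial fractions with \<open>x = -p\<close>, \<open>y = m + p\<close>, so that
  \<open>x + y = m\<close> is constant along a row. The pole terms then sum over \<open>p\<close> to
  \<open>twice_even_zeta i - gen_harm m i\<close>, and \<open>(-p) ^ s\<close> produces the
  sign.\<close>

lemma tornheim_row_sum:
  assumes "s \<ge> 1"
  shows "tornheim s s s = (-1) ^ s * (\<Sum>i=1..s. real ((2 * s - i - 1) choose (s - 1)) *
    (twice_even_zeta i * zeta (real (3 * s - i)) - (\<Sum>n. gen_harm (Suc n) i / real (Suc n) ^ (3 * s - i))))"
proof -
  define c where "c = (\<lambda>i. real ((2 * s - i - 1) choose (s - 1)))"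
  let ?g = "\<lambda>n. (-1) ^ s * (\<Sum>i=1..s. c i *
    (twice_even_zeta i * (1 / real n ^ (3 * s - i)) - gen_harm n i / real n ^ (3 * s - i)))"
  have "(?g has_sum tornheim s s s) {1..}"
  proof (rule tornheim_rows[OF assms assms assms])
    fix m :: nat assume m: "m \<ge> 1"
    have "((\<lambda>p. (-1) ^ s / real m ^ s * (\<Sum>i=1..s. c i / real m ^ (2 * s - i) *
        (1 / (- real p) ^ i + 1 / (real m + real p) ^ i))) has_sum
        (-1) ^ s / real m ^ s * (\<Sum>i=1..s. c i / real m ^ (2 * s - i) *
        (twice_even_zeta i - gen_harm m i))) {1..}"
      by (intro has_sum_cmult_right has_sum_finite_sum signed_tail_has_sum) auto
    moreover have "(-1) ^ s / real m ^ s * (\<Sum>i=1..s. c i / real m ^ (2 * s - i) *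
        (1 / (- real p) ^ i + 1 / (real m + real p) ^ i))
      = 1 / (real m ^ s * real p ^ s * real (m + p) ^ s)" if "p \<in> {1..}" for p
    proof -
      have "(\<Sum>i=1..s. c i / real m ^ (2 * s - i) * (1 / (- real p) ^ i + 1 / (real m + real p) ^ i))
          = 1 / ((- real p) ^ s * (real m + real p) ^ s)"
        using partial_fractions[of "- real p" "real m + real p" s] assms m that by (simp add: c_def)
      also have "\<dots> = (-1) ^ s / (real p ^ s * (real m + real p) ^ s)"
        by (cases "even s") auto
      finally show ?thesis by (simp add: mult_ac flip: power_add)
    qed
    ultimately have "((\<lambda>p. 1 / (real m ^ s * real p ^ s * real (m + p) ^ s)) has_sum
        (-1) ^ s / real m ^ s * (\<Sum>i=1..s. c i / real m ^ (2 * s - i) *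
        (twice_even_zeta i - gen_harm m i))) {1..}"
      by (rule has_sum_cong[THEN iffD1, rotated])
    moreover have "(-1) ^ s / real m ^ s * (\<Sum>i=1..s. c i / real m ^ (2 * s - i) *
        (twice_even_zeta i - gen_harm m i)) = ?g m"
      unfolding sum_distrib_left
    proof (rule sum.cong)
      fix i assume "i \<in> {1..s}"
      then have "3 * s - i = s + (2 * s - i)" by auto
      then have "real m ^ (3 * s - i) = real m ^ s * real m ^ (2 * s - i)" by (simp add: power_add)
      then show "(-1) ^ s / real m ^ s * (c i / real m ^ (2 * s - i) * (twice_even_zeta i - gen_harm m i))
          = (-1) ^ s * (c i * (twice_even_zeta i * (1 / real m ^ (3 * s - i)) - gen_harm m i / real m ^ (3 * s - i)))"
        by (simp add: right_diff_distrib diff_divide_distrib)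
    qed simp
    ultimately show "((\<lambda>p. 1 / (real m ^ s * real p ^ s * real (m + p) ^ s)) has_sum ?g m) {1..}"
      by simp
  qed
  moreover have "(?g has_sum (-1) ^ s * (\<Sum>i=1..s. c i *
    (twice_even_zeta i * zeta (real (3 * s - i)) - (\<Sum>n. gen_harm (Suc n) i / real (Suc n) ^ (3 * s - i))))) {1..}"
    by (intro has_sum_cmult_right has_sum_finite_sum has_sum_diff gen_harm_has_sum zeta_has_sum) auto
  ultimately show ?thesis unfolding c_def by (rule has_sum_unique)
qed

section \<open>Solving the two linear equations\<close>

theorem theorem5p14:
  fixes s :: nat
  assumes "s \<ge> 1"
  shows "(\<Sum>i=2..s. real ((2 * s - i - 1) choose (s - 1)) *
            (\<Sum>n. gen_harm (Suc n) i / real (Suc n) ^ (3 * s - i)))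
       = real ((2 * s - 1) choose (s - 1)) * (2 * zeta (3 * real s) / (2 + (-1) ^ s))
         - real ((2 * s - 2) choose (s - 1)) * ((3 * real s + 1) * zeta (3 * real s) / 2)
         + 1/2 * real ((2 * s - 2) choose (s - 1)) *
             (\<Sum>i=1..3 * s - 3. zeta (3 * real s - real i - 1) * zeta (real i + 1))
         + 2 / (2 * (-1) ^ s + 1) *
             (\<Sum>i=1..s div 2. real ((2 * s - 2 * i - 1) choose (s - 1)) *
                zeta (2 * real i) * zeta (3 * real s - 2 * real i))"
proof -
  define c where "c = (\<lambda>i. real ((2 * s - i - 1) choose (s - 1)))"
  define S where "S = (\<lambda>i. \<Sum>n. gen_harm (Suc n) i / real (Suc n) ^ (3 * s - i))"
  define C where "C = real ((2 * s - 1) choose (s - 1))"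
  define C2 where "C2 = real ((2 * s - 2) choose (s - 1))"
  define Z where "Z = zeta (3 * real s)"
  define X where "X = (\<Sum>i=1..s. c i * S i)"
  define W where "W = (\<Sum>i=1..s div 2. real ((2 * s - 2 * i - 1) choose (s - 1)) *
                zeta (2 * real i) * zeta (3 * real s - 2 * real i))"
  define E where "E = (\<Sum>i=1..3 * s - 3. zeta (3 * real s - real i - 1) * zeta (real i + 1))"
  have sum_c: "(\<Sum>i=1..s. c i) = C"
    unfolding c_def C_def using sum_choose_central[OF assms] by (simp flip: of_nat_sum)
  \<comment> \<open>Odd indices contribute 0; the even ones are reindexed as \<open>2 * i\<close>
    with \<open>i <= s div 2\<close>.\<close>
  have W: "(\<Sum>i=1..s. c i * (twice_even_zeta i * zeta (real (3 * s - i)))) = 2 * W"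
  proof -
    have "(\<Sum>i=1..s. c i * (twice_even_zeta i * zeta (real (3 * s - i))))
        = (\<Sum>i\<in>(*) 2 ` {1..s div 2}. c i * (twice_even_zeta i * zeta (real (3 * s - i))))"
      by (rule sum.mono_neutral_right) (auto simp: twice_even_zeta_def elim!: evenE)
    also have "\<dots> = 2 * W"
      by (subst sum.reindex)
        (auto simp: W_def c_def twice_even_zeta_def sum_distrib_left of_nat_diff inj_on_def intro!: sum.cong)
    finally show ?thesis .
  qed
  have T1: "tornheim s s s = 2 * (X - C * Z)"
    using tornheim_diagonal_sum[OF assms] unfolding sum_c[symmetric]
    by (simp only: S_def c_def Z_def X_def right_diff_distrib sum_subtractf
      sum_distrib_right of_nat_mult of_nat_numeral)
  have T2: "tornheim s s s = (-1) ^ s * (2 * W - X)"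
    using tornheim_row_sum[OF assms]
    by (simp only: W[unfolded c_def] S_def c_def X_def right_diff_distrib sum_subtractf)
  \<comment> \<open>Equating both values gives
    \<open>(2 + (-1) ^ s) * X = 2 * C * Z + 2 * (-1) ^ s * W\<close>. The coefficient of
    \<open>W\<close> takes the stated form because \<open>(-1) ^ s\<close> is its own
    inverse.\<close>
  have X: "X = C * (2 * Z / (2 + (-1) ^ s)) + 2 / (2 * (-1) ^ s + 1) * W"
    using T1 T2 by (cases "even s") (auto simp: field_simps)
  \<comment> \<open>Euler's formula with \<open>q = 3 * s - 1\<close>, which is at least 2; its
    range of \<open>i\<close> becomes \<open>{1..3 * s - 3}\<close>, empty for
    \<open>s = 1\<close>.\<close>
  have S1: "S 1 = (3 * real s + 1) / 2 * Z - 1 / 2 * E"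
  proof -
    have "S 1 = (real (3 * s - 1) + 2) / 2 * zeta (real (3 * s - 1 + 1))
        - 1 / 2 * (\<Sum>i\<in>{1..<3 * s - 1 - 1}. zeta (real (i + 1)) * zeta (real (3 * s - 1 - i)))"
      unfolding S_def using assms by (intro euler_sum) auto
    also have "{1..<3 * s - 1 - 1} = {1..3 * s - 3}" using assms by auto
    also have "(\<Sum>i\<in>{1..3 * s - 3}. zeta (real (i + 1)) * zeta (real (3 * s - 1 - i))) = E"
      unfolding E_def using assms
      by (intro sum.cong) (auto simp: of_nat_diff mult.commute add.commute diff_diff_eq)
    finally show ?thesis using assms by (simp add: Z_def of_nat_diff add.commute)
  qed
  have "{1..s} = insert 1 {2..s}" using assms by auto
  moreover have "c 1 = C2" by (simp add: c_def C2_def numeral_2_eq_2)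
  ultimately have "X = C2 * S 1 + (\<Sum>i=2..s. c i * S i)" by (simp add: X_def)
  then have "(\<Sum>i=2..s. c i * S i) = C * (2 * Z / (2 + (-1) ^ s))
      - C2 * ((3 * real s + 1) * Z / 2) + 1/2 * C2 * E + 2 / (2 * (-1) ^ s + 1) * W"
    unfolding X S1 by (simp add: algebra_simps)
  then show ?thesis unfolding c_def S_def C_def C2_def Z_def W_def E_def .
qed

end
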